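(* Let $k\ge 1$. For every instance of online unweighted any-order interval selection with revocable decisions in which the intervals have at most $k$ distinct lengths, and every arrival order, the following algorithm maintains a feasible solution and its final solution satisfies $\mathrm{OPT}\le 2k\cdot \mathrm{ALG}$. Algorithm: on arrival of an interval $I$, if $I$ conflicts with no interval of the current solution, take $I$; otherwise, if $I$ is properly contained in some interval $I'$ of the current solution ($I\subsetneq I'$), take $I$ and discard $I'$; otherwise discard $I$. (The algorithm does not need to know $k$.)
   Context: Intervals are half-open $[s_i,f_i)$ with $s_i<f_i$ real; two intervals conflict if they intersect. Intervals arrive online one at a time in an arbitrary adversarial order. The algorithm must decide immediately on each arriving interval, maintaining at all times a set of pairwise non-conflicting intervals. Revocable decisions: the algorithm may accept a newly arrived interval and simultaneously discard any currently held intervals conflicting with it; a discarded or rejected interval can never be taken again. $\mathrm{ALG}$ is the number of intervals in the final solution, $\mathrm{OPT}$ the maximum number of pairwise non-conflicting intervals among all arrived intervals; the competitive ratio is $\mathrm{OPT}/\mathrm{ALG}$ (no additive constant). The length of $[s,f)$ is $f-s$. *)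

theory Defs
  imports Complex_Main
begin

type_synonym interval = "real \<times> real"

definition points :: "interval \<Rightarrow> real set" where
  "points I = {fst I..<snd I}"

definition len :: "interval \<Rightarrow> real" where
  "len I = snd I - fst I"

definition conflict :: "interval \<Rightarrow> interval \<Rightarrow> bool" where
  "conflict I J \<longleftrightarrow> points I \<inter> points J \<noteq> {}"

text \<open>
  An instance is the list of intervals in order of arrival.  A solution is a set of positions of
  that list rather than a set of intervals, so that repeated arrivals of the same interval remain
  different items and an item that was rejected or discarded is distinguishable from a later copy.
\<close>

definition is_instance :: "interval list \<Rightarrow> bool" where
  "is_instance xs \<longleftrightarrow> (\<forall>I \<in> set xs. fst I < snd I)"

definition lengths :: "interval list \<Rightarrow> real set" where
  "lengths xs = len ` set xs"

text \<open>Feasibility with respect to the first \<open>n\<close> arrivals.\<close>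

definition feasible :: "interval list \<Rightarrow> nat \<Rightarrow> nat set \<Rightarrow> bool" where
  "feasible xs n S \<longleftrightarrow>
     S \<subseteq> {..<n} \<and> (\<forall>i\<in>S. \<forall>j\<in>S. i \<noteq> j \<longrightarrow> \<not> conflict (xs ! i) (xs ! j))"

definition OPT :: "interval list \<Rightarrow> nat" where
  "OPT xs = Max (card ` {S. feasible xs (length xs) S})"

text \<open>
  \<open>S n\<close> is the solution held after \<open>n\<close> arrivals; the next item to arrive has position \<open>n\<close>.
  Items can only enter the solution at their arrival, and only held items that conflict with
  a newly accepted one may be discarded.
\<close>

definition revocable_run :: "interval list \<Rightarrow> (nat \<Rightarrow> nat set) \<Rightarrow> bool" where
  "revocable_run xs S \<longleftrightarrow>
     S 0 = {} \<and>
     (\<forall>n < length xs. S (Suc n) = S n \<or>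
        (\<exists>D \<subseteq> {i \<in> S n. conflict (xs ! n) (xs ! i)}. S (Suc n) = insert n (S n - D))) \<and>
     (\<forall>n \<le> length xs. feasible xs n (S n))"

text \<open>
  The choice in the second branch is in fact forced: as long as the held intervals are pairwise
  non-conflicting, at most one of them contains the (nonempty) arriving interval.
\<close>

definition alg_step :: "interval list \<Rightarrow> nat \<Rightarrow> nat set \<Rightarrow> nat set" where
  "alg_step xs n S =
     (if \<forall>i\<in>S. \<not> conflict (xs ! n) (xs ! i) then insert n S
      else if \<exists>i\<in>S. points (xs ! n) \<subset> points (xs ! i)
        then insert n (S - {SOME i. i \<in> S \<and> points (xs ! n) \<subset> points (xs ! i)})
      else S)"

primrec alg :: "interval list \<Rightarrow> nat \<Rightarrow> nat set" where
  "alg xs 0 = {}"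
| "alg xs (Suc n) = alg_step xs n (alg xs n)"

definition ALG :: "interval list \<Rightarrow> nat" where
  "ALG xs = card (alg xs (length xs))"

end

theory Submission
  imports Defs
begin

text \<open>
  If \<open>J\<close> is rejected because of a held interval \<open>I\<close>, then \<open>J\<close> meets \<open>I\<close> without lying
  properly inside it, so \<open>J\<close> covers the left end of \<open>I\<close> or the points just before its right end.
  Two disjoint intervals cannot cover the same end, so an optimal solution has at most twice as many
  intervals as were ever accepted.  The accepted intervals split into chains of successive
  replacements, one chain for each interval of the final solution; lengths strictly decrease along
  a chain, so a chain has at most \<open>k\<close> members.
\<close>

section \<open>Conflict and containment in terms of endpoints\<close>

definition covers_left :: "interval \<Rightarrow> interval \<Rightarrow> bool" where
  "covers_left J I \<longleftrightarrow> fst J \<le> fst I \<and> fst I < snd J"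

text \<open>With half-open intervals \<open>snd I\<close> is not a point of \<open>I\<close>, hence
  strict and weak inequality trade places. Two intervals covering the right end of the same
  \<open>I\<close> still overlap, just below \<open>snd I\<close>.\<close>

definition covers_right :: "interval \<Rightarrow> interval \<Rightarrow> bool" where
  "covers_right J I \<longleftrightarrow> fst J < snd I \<and> snd I \<le> snd J"

lemma conflict_iff:
  assumes "fst I < snd I" "fst J < snd J"
  shows "conflict I J \<longleftrightarrow> fst I < snd J \<and> fst J < snd I"
proof -
  have "points I \<inter> points J = {max (fst I) (fst J)..<min (snd I) (snd J)}"
    by (auto simp: points_def)
  then show ?thesis
    using assms by (auto simp: conflict_def)
qed

lemma points_psubset_iff:
  assumes "fst I < snd I"
  shows "points I \<subset> points J \<longleftrightarrow> fst J \<le> fst I \<and> snd I \<le> snd J \<and> I \<noteq> J"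
  using assms Ico_eq_Ico[of "fst I" "snd I" "fst J" "snd J"]
  by (auto simp: points_def psubset_eq prod_eq_iff)

lemma points_psubset_len_less:
  assumes "fst I < snd I" "points I \<subset> points J"
  shows "len I < len J"
  using assms by (auto simp: points_psubset_iff len_def prod_eq_iff)

lemma conflict_commute: "conflict I J \<longleftrightarrow> conflict J I"
  by (auto simp: conflict_def)

lemma conflict_mono: "points I \<subseteq> points I' \<Longrightarrow> conflict I J \<Longrightarrow> conflict I' J"
  by (auto simp: conflict_def)

lemma covers_end_if_conflict:
  assumes "fst I < snd I" "fst J < snd J" "conflict J I" "\<not> points J \<subset> points I"
  shows "covers_left J I \<or> covers_right J I"
  using assms by (auto simp: conflict_iff points_psubset_iff covers_left_def covers_right_def)

lemma is_instance_nth: "is_instance xs \<Longrightarrow> n < length xs \<Longrightarrow> fst (xs ! n) < snd (xs ! n)"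
  by (auto simp: is_instance_def)

section \<open>The algorithm as a feasible revocable run\<close>

text \<open>Hides the choice operator: later proofs need only some held \<open>i\<close> containing
  the arrival. Since the arrival is nonempty, containment forces a conflict, so discarding
  \<open>i\<close> is a legal revocation.\<close>

lemma alg_step_cases [consumes 1, case_names accept replace reject]:
  assumes "fst (xs ! n) < snd (xs ! n)"
  obtains
    "\<forall>i\<in>S. \<not> conflict (xs ! n) (xs ! i)" "alg_step xs n S = insert n S"
  | i where "i \<in> S" "points (xs ! n) \<subset> points (xs ! i)" "conflict (xs ! n) (xs ! i)"
      "alg_step xs n S = insert n (S - {i})"
  | i where "i \<in> S" "conflict (xs ! n) (xs ! i)" "\<not> points (xs ! n) \<subset> points (xs ! i)"
      "alg_step xs n S = S"
proof (cases "\<forall>i\<in>S. \<not> conflict (xs ! n) (xs ! i)")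
  case True
  then show ?thesis using that(1) by (simp add: alg_step_def)
next
  case False
  show ?thesis
  proof (cases "\<exists>i\<in>S. points (xs ! n) \<subset> points (xs ! i)")
    case True
    define i where "i = (SOME i. i \<in> S \<and> points (xs ! n) \<subset> points (xs ! i))"
    have i: "i \<in> S" "points (xs ! n) \<subset> points (xs ! i)"
      using someI_ex[of "\<lambda>i. i \<in> S \<and> points (xs ! n) \<subset> points (xs ! i)"] True
      by (auto simp: i_def)
    moreover have "conflict (xs ! n) (xs ! i)"
      using i(2) assms by (auto simp: conflict_def points_def)
    moreover have "alg_step xs n S = insert n (S - {i})"
      unfolding alg_step_def i_def using False True by (simp only: if_False if_True)
    ultimately show ?thesis using that(2) by blast
  next
    case nosub: False
    obtain i where "i \<in> S" "conflict (xs ! n) (xs ! i)"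
      using False by blast
    then show ?thesis using that(3)[of i] False nosub by (auto simp: alg_step_def)
  qed
qed

lemma feasible_insert:
  assumes "feasible xs n S" "\<forall>i\<in>S. \<not> conflict (xs ! n) (xs ! i)"
  shows "feasible xs (Suc n) (insert n S)"
proof -
  have "\<forall>i\<in>S. \<not> conflict (xs ! i) (xs ! n)"
    using assms(2) by (simp add: conflict_commute)
  then show ?thesis
    using assms by (auto simp: feasible_def)
qed

lemma feasible_alg:
  assumes "is_instance xs" "n \<le> length xs"
  shows "feasible xs n (alg xs n)"
  using assms(2)
proof (induction n)
  case 0
  then show ?case by (simp add: feasible_def)
next
  case (Suc n)
  then have IH: "feasible xs n (alg xs n)" by simp
  have "fst (xs ! n) < snd (xs ! n)"
    using is_instance_nth[OF assms(1)] Suc.prems by simp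
  then show ?case
  proof (cases rule: alg_step_cases[where S = "alg xs n"])
    case accept
    then show ?thesis
      using feasible_insert[OF IH] by simp
  next
    case (replace i)
    \<comment> \<open>A conflict of the smaller new interval with \<open>j\<close> would already be
      a conflict of \<open>i\<close> with \<open>j\<close>, both held.\<close>
    have "\<not> conflict (xs ! n) (xs ! j)" if "j \<in> alg xs n - {i}" for j
      using that IH replace(1,2) conflict_mono[of "xs ! n" "xs ! i" "xs ! j"]
      by (auto simp: feasible_def)
    then show ?thesis
      using feasible_insert[of xs n "alg xs n - {i}"] IH replace(4) by (auto simp: feasible_def)
  next
    case (reject i)
    then show ?thesis using IH by (auto simp: feasible_def)
  qed
qed

lemma revocable_run_alg:
  assumes "is_instance xs"
  shows "revocable_run xs (alg xs)"
proof -
  have "alg xs (Suc n) = alg xs n \<or>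
      (\<exists>D \<subseteq> {i \<in> alg xs n. conflict (xs ! n) (xs ! i)}. alg xs (Suc n) = insert n (alg xs n - D))"
    if "n < length xs" for n
    using is_instance_nth[OF assms that]
  proof (cases rule: alg_step_cases[where S = "alg xs n"])
    case accept
    then show ?thesis by (intro disjI2 exI[of _ "{}"]) auto
  next
    case (replace i)
    then show ?thesis by (intro disjI2 exI[of _ "{i}"]) auto
  next
    case (reject i)
    then show ?thesis by simp
  qed
  then show ?thesis
    using feasible_alg[OF assms] by (simp add: revocable_run_def)
qed

section \<open>Chains of replacements\<close>

text \<open>
  \<open>T\<close> is the set of items accepted so far, and \<open>h\<close> sends each of them to the held item
  at the end of its chain of replacements.
\<close>

lemma accepted_chains:
  assumes "is_instance xs" "n \<le> length xs"
  shows "\<exists>T h. T \<subseteq> {..<n} \<and> alg xs n \<subseteq> T \<and> h ` T \<subseteq> alg xs n \<and>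
    (\<forall>j\<in>T. len (xs ! h j) \<le> len (xs ! j)) \<and> inj_on (\<lambda>j. (h j, len (xs ! j))) T \<and>
    (\<forall>m<n. \<exists>j\<in>T. covers_left (xs ! m) (xs ! j) \<or> covers_right (xs ! m) (xs ! j))"
  using assms(2)
proof (induction n)
  case 0
  then show ?case by auto
next
  case (Suc n)
  then have n: "n < length xs" by simp
  obtain T h where T: "T \<subseteq> {..<n}" and held: "alg xs n \<subseteq> T"
    and h: "h ` T \<subseteq> alg xs n"
    and len: "\<forall>j\<in>T. len (xs ! h j) \<le> len (xs ! j)"
    and inj: "inj_on (\<lambda>j. (h j, len (xs ! j))) T"
    and cov: "\<forall>m<n. \<exists>j\<in>T. covers_left (xs ! m) (xs ! j) \<or> covers_right (xs ! m) (xs ! j)"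
    using Suc by auto
  have sub: "alg xs n \<subseteq> {..<n}"
    using feasible_alg[OF assms(1), of n] n by (simp add: feasible_def)
  have hT: "h j < n" if "j \<in> T" for j
    using that h sub by auto
  have pos: "fst (xs ! n) < snd (xs ! n)"
    using is_instance_nth[OF assms(1) n] .
  then have "covers_left (xs ! n) (xs ! n)"
    by (simp add: covers_left_def)
  \<comment> \<open>An accepted item covers its own left end, and discarded items stay in
    \<open>T\<close>, so old coverage is never lost.\<close>
  then have cov': "\<forall>m<Suc n. \<exists>j\<in>insert n T.
      covers_left (xs ! m) (xs ! j) \<or> covers_right (xs ! m) (xs ! j)"
    using cov by (auto simp: less_Suc_eq)
  from pos show ?case
  proof (cases rule: alg_step_cases[where S = "alg xs n"])
    case accept
    \<comment> \<open>The new item starts its own chain; the ends of the old chains are all below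
      \<open>n\<close>.\<close>
    have "inj_on (\<lambda>j. ((h(n := n)) j, len (xs ! j))) (insert n T)"
      using inj hT T by (fastforce simp: inj_on_def)
    then show ?thesis
      using T held h len cov' accept by (intro exI[of _ "insert n T"] exI[of _ "h(n := n)"]) auto
  next
    case (replace i)
    \<comment> \<open>The chain that ended in \<open>i\<close> now ends in \<open>n\<close>; all
      other chains keep their ends.\<close>
    define h' where "h' = (\<lambda>j. if j = n \<or> h j = i then n else h j)"
    have lt: "len (xs ! n) < len (xs ! i)"
      using points_psubset_len_less[OF pos replace(2)] .
    \<comment> \<open>Here the invariant \<open>len\<close> pays off: the end \<open>i\<close> is no
      longer than any member of its chain, and \<open>n\<close> is strictly shorter than
      \<open>i\<close>.\<close>
    have chain: "len (xs ! n) < len (xs ! j)" if "j \<in> T" "h j = i" for j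
      using that len lt by fastforce
    have new: "h' j \<noteq> n \<or> len (xs ! n) < len (xs ! j)" if "j \<in> T" for j
    proof (cases "h j = i")
      case True
      then show ?thesis using chain that by simp
    next
      case False
      then show ?thesis using that hT[OF that] T by (auto simp: h'_def)
    qed
    \<comment> \<open>On \<open>T\<close>, \<open>h'\<close> merely renames the end \<open>i\<close>
      to \<open>n\<close>, which is not a value of \<open>h\<close> there, so no two chains are
      merged.\<close>
    have "h a = h b" if "a \<in> T" "b \<in> T" "h' a = h' b" for a b
    proof -
      have "a \<noteq> n" "b \<noteq> n" "h a \<noteq> n" "h b \<noteq> n"
        using that(1,2) hT[OF that(1)] hT[OF that(2)] T by auto
      then show ?thesis
        using that(3) by (simp add: h'_def split: if_splits)
    qed
    then have "inj_on (\<lambda>j. (h' j, len (xs ! j))) T"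
      using inj unfolding inj_on_def prod.inject by blast
    moreover have "(h' n, len (xs ! n)) \<notin> (\<lambda>j. (h' j, len (xs ! j))) ` T"
    proof
      assume "(h' n, len (xs ! n)) \<in> (\<lambda>j. (h' j, len (xs ! j))) ` T"
      then obtain j where "j \<in> T" "h' j = n" "len (xs ! j) = len (xs ! n)"
        by (auto simp: h'_def)
      then show False using new[of j] by simp
    qed
    ultimately have "inj_on (\<lambda>j. (h' j, len (xs ! j))) (insert n T)"
      by (auto simp: inj_on_insert)
    moreover have "h' ` insert n T \<subseteq> alg xs (Suc n)"
      using h replace(4) by (auto simp: h'_def)
    moreover have "\<forall>j\<in>insert n T. len (xs ! h' j) \<le> len (xs ! j)"
      using len lt by (fastforce simp: h'_def)
    ultimately show ?thesis
      using T held cov' replace(4) by (intro exI[of _ "insert n T"] exI[of _ h']) auto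
  next
    case (reject i)
    have "i \<in> T" "i < length xs"
      using reject(1) held T n by auto
    then have "\<exists>j\<in>T. covers_left (xs ! n) (xs ! j) \<or> covers_right (xs ! n) (xs ! j)"
      using covers_end_if_conflict[OF is_instance_nth[OF assms(1)] pos reject(2,3)] by blast
    then show ?thesis
      using T held h len inj cov reject(4)
      by (intro exI[of _ T] exI[of _ h]) (auto simp: less_Suc_eq)
  qed
qed

section \<open>Counting against an arbitrary feasible set\<close>

lemma feasible_disjoint:
  assumes "is_instance xs" "n \<le> length xs" "feasible xs n S" "a \<in> S" "b \<in> S" "a \<noteq> b"
  shows "\<not> (fst (xs ! a) < snd (xs ! b) \<and> fst (xs ! b) < snd (xs ! a))"
proof -
  have "a < length xs" "b < length xs"
    using assms by (auto simp: feasible_def)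
  then show ?thesis
    using assms conflict_iff[of "xs ! a" "xs ! b"] is_instance_nth[OF assms(1)]
    by (auto simp: feasible_def)
qed

lemma card_feasible_le:
  assumes "is_instance xs" "feasible xs (length xs) S" "finite T"
    and cov: "\<forall>m<length xs. \<exists>j\<in>T. covers_left (xs ! m) (xs ! j) \<or> covers_right (xs ! m) (xs ! j)"
  shows "card S \<le> 2 * card T"
proof -
  have S: "S \<subseteq> {..<length xs}"
    using assms(2) by (simp add: feasible_def)
  then obtain g where g: "\<And>m. m \<in> S \<Longrightarrow> g m \<in> T \<and>
      (covers_left (xs ! m) (xs ! g m) \<or> covers_right (xs ! m) (xs ! g m))"
    using cov by (metis subsetD lessThan_iff)
  \<comment> \<open>The Boolean names the covered end: if it is false, the choice of
    \<open>g\<close> forces the right end. Equal images thus mean a common covered end, impossible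
    for two members of \<open>S\<close>.\<close>
  let ?f = "\<lambda>m. (g m, covers_left (xs ! m) (xs ! g m))"
  have "inj_on ?f S"
  proof (rule inj_onI, rule ccontr)
    fix a b assume ab: "a \<in> S" "b \<in> S" "?f a = ?f b" "a \<noteq> b"
    show False
      using feasible_disjoint[OF assms(1) order_refl assms(2) ab(1,2,4)] g[OF ab(1)] g[OF ab(2)] ab(3)
      by (auto simp: covers_left_def covers_right_def)
  qed
  moreover have "?f ` S \<subseteq> T \<times> UNIV"
    using g by auto
  ultimately have "card S \<le> card (T \<times> (UNIV :: bool set))"
    using assms(3) by (intro card_inj_on_le) auto
  then show ?thesis by (simp add: card_cartesian_product)
qed

theorem theorem1:
  fixes k :: nat and xs :: "interval list"
  assumes "k \<ge> 1"
    and "is_instance xs"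
    and "card (lengths xs) \<le> k"
  shows "revocable_run xs (alg xs) \<and> OPT xs \<le> 2 * k * ALG xs"
proof
  show "revocable_run xs (alg xs)"
    using revocable_run_alg[OF assms(2)] .
  obtain T h where T: "T \<subseteq> {..<length xs}" and h: "h ` T \<subseteq> alg xs (length xs)"
    and inj: "inj_on (\<lambda>j. (h j, len (xs ! j))) T"
    and cov: "\<forall>m<length xs. \<exists>j\<in>T. covers_left (xs ! m) (xs ! j) \<or> covers_right (xs ! m) (xs ! j)"
    using accepted_chains[OF assms(2) order_refl] by blast
  have finT: "finite T"
    using T finite_subset by blast
  have fin: "finite (alg xs (length xs))"
    using feasible_alg[OF assms(2) order_refl] finite_subset by (auto simp: feasible_def)
  \<comment> \<open>An accepted item is determined by the end of its chain and its length.\<close>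
  have "card T \<le> card (alg xs (length xs) \<times> lengths xs)"
  proof (rule card_inj_on_le[OF inj])
    show "(\<lambda>j. (h j, len (xs ! j))) ` T \<subseteq> alg xs (length xs) \<times> lengths xs"
      using T h by (auto simp: lengths_def)
    show "finite (alg xs (length xs) \<times> lengths xs)"
      using fin by (simp add: lengths_def)
  qed
  also have "\<dots> = ALG xs * card (lengths xs)"
    by (simp add: card_cartesian_product ALG_def)
  also have "\<dots> \<le> ALG xs * k"
    using assms(3) by simp
  finally have cardT: "card T \<le> ALG xs * k" .
  have bound: "card S \<le> 2 * k * ALG xs" if "feasible xs (length xs) S" for S
    using card_feasible_le[OF assms(2) that finT cov] cardT by (simp add: ac_simps)
  \<comment> \<open>\<open>Max\<close> is meaningful only on a finite nonempty set; the empty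
    solution provides a member.\<close>
  have "{S. feasible xs (length xs) S} \<subseteq> Pow {..<length xs}"
    by (auto simp: feasible_def)
  then have "finite {S. feasible xs (length xs) S}"
    using finite_subset by blast
  moreover have "feasible xs (length xs) {}"
    by (simp add: feasible_def)
  ultimately show "OPT xs \<le> 2 * k * ALG xs"
    using bound unfolding OPT_def by (subst Max_le_iff) auto
qed

end
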